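(* Let $L_1\ge L_2>0$, $\Omega=(0,L_1)\times(0,L_2)$ (so $n=2$) and $V_\Omega\equiv0$. Then for $0<\alpha\le 2$ the fundamental gap $\delta_{\rm per}(\alpha)$ of the fractional Schrödinger operator $(-\Delta)^{\alpha/2}+V_\Omega=(-\Delta)^{\alpha/2}$ on $\Omega$ with periodic boundary conditions is $$\delta_{\rm per}(\alpha)=\begin{cases}\dfrac{(2\pi)^{\alpha}(2^{\alpha/2}-1)}{L_1^{\alpha}}, & \text{if } L_1=L_2,\\[2mm] \dfrac{(2\pi)^{\alpha}}{L_2^{\alpha}}-\dfrac{(2\pi)^{\alpha}}{L_1^{\alpha}}, & \text{if } L_2<L_1\le 2L_2,\\[2mm] \dfrac{(2\pi)^{\alpha}(2^{\alpha}-1)}{L_1^{\alpha}}, & \text{if } L_1\ge 2L_2.\end{cases}$$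
   Context: For $\Omega=\prod_{j=1}^n(0,L_j)$ consider the eigenvalue problem $[(-\Delta)^{\alpha/2}+V_\Omega(\mathbf x)]\phi=\lambda\phi$ in $\Omega$ with $\phi$ periodic with respect to $\Omega$ (period $L_j$ in the $j$-th coordinate), $\phi\neq0$. In the periodic setting, $(-\Delta)^{\alpha/2}$ is defined through the spectral decomposition of the periodic Laplacian: it acts on $e^{i\mathbf k\cdot\mathbf x}$, $\mathbf k=(2\pi m_1/L_1,\dots,2\pi m_n/L_n)$, $\mathbf m\in\mathbb Z^n$, as multiplication by $|\mathbf k|^{\alpha}$. The fundamental gap is $\delta_{\rm per}(\alpha):=\lambda_2(\alpha)-\lambda_1(\alpha)$, where $0<\lambda_1(\alpha)<\lambda_2(\alpha)$ are the two smallest distinct strictly positive eigenvalues (for $V_\Omega\equiv0$ the eigenvalue $0$, with constant eigenfunction, is not counted). *)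

theory Defs
  imports "HOL-Analysis.Analysis"
begin

text \<open>
  The period cell is \<open>\<Omega> = box 0 L\<close>, where \<open>L $ j\<close> is the period in the \<open>j\<close>-th coordinate.
  Functions on the torus are represented by \<open>L\<close>-periodic functions on the whole space;
  elements of \<open>L\<^sup>2\<close> are only compared almost everywhere on \<open>\<Omega>\<close>.
\<close>

definition periodic :: "real^'n \<Rightarrow> (real^'n \<Rightarrow> complex) \<Rightarrow> bool" where
  "periodic L f \<longleftrightarrow> (\<forall>x j. f (x + axis j (L $ j)) = f x)"

definition L2_per :: "real^'n \<Rightarrow> (real^'n \<Rightarrow> complex) set" where
  "L2_per L = {f. periodic L f \<and> set_borel_measurable lebesgue (box 0 L) f \<and>
                  set_integrable lebesgue (box 0 L) (\<lambda>x. (cmod (f x))\<^sup>2)}"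

definition wavevec :: "real^'n \<Rightarrow> int^'n \<Rightarrow> real^'n" where
  "wavevec L m = (\<chi> j. 2 * pi * of_int (m $ j) / L $ j)"

definition fourier_mode :: "real^'n \<Rightarrow> int^'n \<Rightarrow> real^'n \<Rightarrow> complex" where
  "fourier_mode L m x = exp (\<i> * of_real (wavevec L m \<bullet> x))"

definition fourier_coeff :: "real^'n \<Rightarrow> (real^'n \<Rightarrow> complex) \<Rightarrow> int^'n \<Rightarrow> complex" where
  "fourier_coeff L f m =
     (LINT x:box 0 L|lebesgue. f x * cnj (fourier_mode L m x)) / of_real (\<Prod>j\<in>UNIV. L $ j)"

text \<open>
  The unbounded operator \<open>(-\<Delta>)\<^bsup>\<alpha>/2\<^esup>\<close> is given by its graph: \<open>f\<close> is in the domain with image \<open>g\<close> iff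
  the series with terms \<open>\<bar>k\<bar>\<^bsup>\<alpha>\<^esup> f\<^sub>k e\<^bsup>ikx\<^esup>\<close>, where \<open>f\<^sub>k\<close> are the Fourier coefficients of \<open>f\<close>,
  converges (unconditionally) to \<open>g\<close> in \<open>L\<^sup>2(\<Omega>)\<close>. The image is unique up to null sets.
\<close>

definition frac_laplacian :: "real \<Rightarrow> real^'n \<Rightarrow> (real^'n \<Rightarrow> complex) \<Rightarrow> (real^'n \<Rightarrow> complex) \<Rightarrow> bool" where
  "frac_laplacian \<alpha> L f g \<longleftrightarrow> f \<in> L2_per L \<and> g \<in> L2_per L \<and>
     ((\<lambda>M. LINT x:box 0 L|lebesgue.
        (cmod (g x - (\<Sum>m\<in>M. of_real (norm (wavevec L m) powr \<alpha>) *
                              fourier_coeff L f m * fourier_mode L m x)))\<^sup>2)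
      \<longlongrightarrow> 0) (finite_subsets_at_top UNIV)"

definition eigenfunction ::
  "real \<Rightarrow> (real^'n \<Rightarrow> real) \<Rightarrow> real^'n \<Rightarrow> real \<Rightarrow> (real^'n \<Rightarrow> complex) \<Rightarrow> bool" where
  "eigenfunction \<alpha> V L \<mu> \<phi> \<longleftrightarrow>
     \<not> (AE x\<in>box 0 L in lebesgue. \<phi> x = 0) \<and>
     (\<exists>\<psi>. frac_laplacian \<alpha> L \<phi> \<psi> \<and>
          (AE x\<in>box 0 L in lebesgue. \<psi> x + of_real (V x) * \<phi> x = of_real \<mu> * \<phi> x))"

definition eigenvalue :: "real \<Rightarrow> (real^'n \<Rightarrow> real) \<Rightarrow> real^'n \<Rightarrow> real \<Rightarrow> bool" where
  "eigenvalue \<alpha> V L \<mu> \<longleftrightarrow> (\<exists>\<phi>. eigenfunction \<alpha> V L \<mu> \<phi>)"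

definition two_smallest_pos_eigenvalues ::
  "real \<Rightarrow> (real^'n \<Rightarrow> real) \<Rightarrow> real^'n \<Rightarrow> real \<Rightarrow> real \<Rightarrow> bool" where
  "two_smallest_pos_eigenvalues \<alpha> V L \<mu>\<^sub>1 \<mu>\<^sub>2 \<longleftrightarrow>
     0 < \<mu>\<^sub>1 \<and> \<mu>\<^sub>1 < \<mu>\<^sub>2 \<and> eigenvalue \<alpha> V L \<mu>\<^sub>1 \<and> eigenvalue \<alpha> V L \<mu>\<^sub>2 \<and>
     (\<forall>\<nu>>0. eigenvalue \<alpha> V L \<nu> \<longrightarrow> \<nu> = \<mu>\<^sub>1 \<or> \<mu>\<^sub>2 \<le> \<nu>)"

lemma two_smallest_pos_eigenvalues_unique:
  assumes "two_smallest_pos_eigenvalues \<alpha> V L a b" "two_smallest_pos_eigenvalues \<alpha> V L c d"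
  shows "a = c \<and> b = d"
  using assms unfolding two_smallest_pos_eigenvalues_def by (smt (verit))

definition fundamental_gap :: "real \<Rightarrow> (real^'n \<Rightarrow> real) \<Rightarrow> real^'n \<Rightarrow> real" where
  "fundamental_gap \<alpha> V L =
     (THE \<delta>. \<exists>\<mu>\<^sub>1 \<mu>\<^sub>2. two_smallest_pos_eigenvalues \<alpha> V L \<mu>\<^sub>1 \<mu>\<^sub>2 \<and> \<delta> = \<mu>\<^sub>2 - \<mu>\<^sub>1)"

end

theory Submission imports Defs begin

text \<open>
  The positive eigenvalues of \<open>(-\<Delta>)\<^bsup>\<alpha>/2\<^esup>\<close> on a torus with periods \<open>L\<close> are exactly the positive
  numbers \<open>\<bar>k\<bar>\<^sup>\<alpha>\<close> with \<open>k\<close> a wave vector, in every dimension (\<open>positive_eigenvalue_iff\<close>).  Since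
  \<open>t \<mapsto> t\<^sup>\<alpha>\<close> is increasing, the gap is then decided by the two shortest distinct positive lengths of
  wave vectors, and in two dimensions these are read off from
  \<open>\<bar>k\<bar>\<^sup>2 = (2\<pi>)\<^sup>2 ((m\<^sub>1/L\<^sub>1)\<^sup>2 + (m\<^sub>2/L\<^sub>2)\<^sup>2)\<close>.

  That each \<open>\<bar>k\<bar>\<^sup>\<alpha>\<close> is an eigenvalue follows from orthogonality of the Fourier modes: the series
  that defines the operator on a single mode has only one nonzero term.

  For the converse, let \<open>(-\<Delta>)\<^bsup>\<alpha>/2\<^esup> f = g\<close> with \<open>g = \<nu> f\<close> almost everywhere.  Fourier coefficients
  are continuous in \<open>L\<^sup>2\<close>, so comparing those of \<open>g\<close> with those of the partial sums gives
  \<open>\<bar>k\<bar>\<^sup>\<alpha> f\<^sub>k = \<nu> f\<^sub>k\<close> for every \<open>k\<close> (\<open>fourier_coeff_frac_laplacian\<close>).  If \<open>\<nu>\<close> were none of the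
  \<open>\<bar>k\<bar>\<^sup>\<alpha>\<close>, all \<open>f\<^sub>k\<close> would vanish; but \<open>g\<close> is the \<open>L\<^sup>2\<close> limit of a series built from these
  coefficients, so \<open>g = 0\<close>, and \<open>f = g / \<nu> = 0\<close> because \<open>\<nu> > 0\<close>.

  The shortest positive length is that of \<open>m = (1, 0)\<close>.  The next one belongs to \<open>(1, 1)\<close> on a
  square, where \<open>(0, 1)\<close> ties with \<open>(1, 0)\<close>; otherwise \<open>(0, 1)\<close> and \<open>(2, 0)\<close> compete, and the
  winner changes at \<open>L\<^sub>1 = 2 L\<^sub>2\<close>.
\<close>

section \<open>Integration over the period cell\<close>

text \<open>The Cauchy-Schwarz inequality against the constant function 1.\<close>
lemma (in finite_measure) integral_norm_squared_le:
  fixes h :: "'a \<Rightarrow> complex"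
  assumes [measurable]: "h \<in> borel_measurable M" and sq: "integrable M (\<lambda>x. (cmod (h x))\<^sup>2)"
  shows "(\<integral>x. cmod (h x) \<partial>M)\<^sup>2 \<le> measure M (space M) * (\<integral>x. (cmod (h x))\<^sup>2 \<partial>M)"
proof -
  have int: "integrable M (\<lambda>x. cmod (h x))"
    using sq by (rule square_integrable_imp_integrable[rotated]) simp
  have "(\<integral>\<^sup>+x. cmod (h x) \<partial>M)\<^sup>2 \<le> (\<integral>\<^sup>+x. (cmod (h x))\<^sup>2 \<partial>M) * emeasure M (space M)"
    using Cauchy_Schwarz_nn_integral[of "\<lambda>x. ennreal (cmod (h x))" M "\<lambda>_. 1"]
    by (simp add: ennreal_power)
  also have "(\<integral>\<^sup>+x. cmod (h x) \<partial>M) = ennreal (\<integral>x. cmod (h x) \<partial>M)"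
    by (rule nn_integral_eq_integral[OF int]) simp
  also have "(\<integral>\<^sup>+x. (cmod (h x))\<^sup>2 \<partial>M) = ennreal (\<integral>x. (cmod (h x))\<^sup>2 \<partial>M)"
    by (rule nn_integral_eq_integral[OF sq]) simp
  finally show ?thesis
    by (simp add: emeasure_eq_measure ennreal_power mult.commute flip: ennreal_mult')
qed

lemma integral_exp_period:
  fixes l :: real and m :: int
  assumes "l > 0" "m \<noteq> 0"
  shows "(LBINT x:{0<..<l}. exp (\<i> * of_real (2 * pi * of_int m / l * x))) = 0"
proof -
  define k where "k = 2 * pi * of_int m / l"
  have k: "k \<noteq> 0" using assms by (simp add: k_def)
  have "(LBINT x=ereal 0..ereal l. exp (\<i> * of_real (k * x)))
        = exp (\<i> * of_real (k * l)) / (\<i> * of_real k) - exp (\<i> * of_real (k * 0)) / (\<i> * of_real k)"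
  proof (rule interval_integral_FTC_finite)
    show "continuous_on {min 0 l..max 0 l} (\<lambda>x. exp (\<i> * of_real (k * x)))"
      by (intro continuous_intros)
    fix x
    show "((\<lambda>x. exp (\<i> * of_real (k * x)) / (\<i> * of_real k)) has_vector_derivative
             exp (\<i> * of_real (k * x))) (at x within {min 0 l..max 0 l})"
      using k by (auto intro!: derivative_eq_intros has_vector_derivative_real_field simp: field_simps)
  qed
  also have "exp (\<i> * of_real (k * l)) = 1"
    using assms exp_integer_2pi[of "of_int m"] by (simp add: k_def mult_ac)
  finally show ?thesis
    using assms by (simp add: interval_integral_Ioo k_def)
qed

text \<open>
  Fubini for a product integrand.  Lebesgue measure on \<open>real^'n\<close> is the image of a product measure
  indexed by \<open>Basis\<close>, so the factors are first moved from the index type \<open>'n\<close> to the basis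
  vectors; the indicator of the box becomes part of the factors.
\<close>
lemma integral_box_prod:
  fixes f :: "'n::finite \<Rightarrow> real \<Rightarrow> complex" and L :: "real^'n"
  assumes int: "\<And>j. set_integrable lborel {0<..<L $ j} (f j)"
   and meas: "(\<lambda>x. \<Prod>j\<in>UNIV. f j (x $ j)) \<in> borel_measurable borel"
  shows "(LINT x:box 0 L|lebesgue. \<Prod>j\<in>UNIV. f j (x $ j)) = (\<Prod>j\<in>UNIV. LBINT t:{0<..<L $ j}. f j t)"
proof -
  interpret product_sigma_finite "\<lambda>_::real^'n. lborel :: real measure" ..
  \<comment> \<open>\<open>THE\<close> recovers the coordinate index from a basis vector.\<close>
  define F where "F b t = indicator {0<..<L \<bullet> b} t *\<^sub>R f (THE j. b = axis j 1) t" for b t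
  have Basis_eq: "(Basis :: (real^'n) set) = range (\<lambda>j. axis j 1)"
    by (auto simp: Basis_vec_def)
  have inj: "inj (\<lambda>j::'n. axis j (1::real))"
    by (auto simp: inj_on_def axis_eq_axis)
  have F_axis: "F (axis j 1) = (\<lambda>t. indicator {0<..<L $ j} t *\<^sub>R f j t)" for j
    by (auto simp: F_def inner_axis axis_eq_axis fun_eq_iff)
  have split: "indicator (box 0 L) x *\<^sub>R (\<Prod>j\<in>UNIV. f j (x $ j)) = (\<Prod>b\<in>Basis. F b (x \<bullet> b))" for x
  proof -
    have "(\<Prod>b\<in>Basis. F b (x \<bullet> b)) = (\<Prod>j\<in>UNIV. indicator {0<..<L $ j} (x $ j) *\<^sub>R f j (x $ j))"
      unfolding Basis_eq by (subst prod.reindex[OF inj]) (simp add: F_axis inner_axis)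
    also have "\<dots> = indicator (box 0 L) x *\<^sub>R (\<Prod>j\<in>UNIV. f j (x $ j))"
      by (auto simp: indicator_def mem_box_cart intro!: prod.cong)
    finally show ?thesis by simp
  qed
  have meas': "(\<lambda>x. indicator (box 0 L) x *\<^sub>R (\<Prod>j\<in>UNIV. f j (x $ j))) \<in> borel_measurable borel"
    using meas by measurable
  have "(LINT x:box 0 L|lebesgue. \<Prod>j\<in>UNIV. f j (x $ j)) = (LINT x|lborel. (\<Prod>b\<in>Basis. F b (x \<bullet> b)))"
    unfolding set_lebesgue_integral_def using meas'
    by (subst integral_completion) (simp_all add: split)
  also have "\<dots> = (\<integral>x. (\<Prod>b\<in>Basis. F b (x b)) \<partial>Pi\<^sub>M Basis (\<lambda>_. lborel))"
    using meas' by (subst lborel_eq, subst integral_distr) (auto simp: split inner_sum_left_Basis)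
  also have "\<dots> = (\<Prod>b\<in>Basis. integral\<^sup>L lborel (F b))"
    by (rule product_integral_prod) (use int in \<open>auto simp: Basis_eq F_axis set_integrable_def\<close>)
  also have "\<dots> = (\<Prod>j\<in>UNIV. LBINT t:{0<..<L $ j}. f j t)"
    unfolding Basis_eq by (subst prod.reindex[OF inj]) (simp add: F_axis set_lebesgue_integral_def)
  finally show ?thesis .
qed

section \<open>Orthogonality of the Fourier modes\<close>

lemma fourier_mode_cart:
  "fourier_mode L m x = (\<Prod>j\<in>UNIV. exp (\<i> * of_real (2 * pi * of_int (m $ j) / L $ j * x $ j)))"
  by (simp add: fourier_mode_def wavevec_def inner_vec_def sum_distrib_left exp_sum)

lemma fourier_mode_mult_cnj: "fourier_mode L m x * cnj (fourier_mode L n x) = fourier_mode L (m - n) x"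
proof -
  have "wavevec L (m - n) = wavevec L m - wavevec L n"
    by (simp add: wavevec_def vec_eq_iff diff_divide_distrib algebra_simps)
  then show ?thesis
    by (simp add: fourier_mode_def exp_cnj inner_diff_left right_diff_distrib exp_diff exp_minus divide_inverse)
qed

lemma continuous_fourier_mode: "continuous_on A (fourier_mode L m)"
  unfolding fourier_mode_def by (intro continuous_intros)

lemma norm_fourier_mode [simp]: "cmod (fourier_mode L m x) = 1"
  by (simp add: fourier_mode_def)

lemma measurable_fourier_mode [measurable]: "fourier_mode L m \<in> borel_measurable borel"
  by (intro borel_measurable_continuous_onI continuous_fourier_mode)

lemma periodic_fourier_mode:
  assumes "\<And>j. L $ j \<noteq> 0"
  shows "periodic L (fourier_mode L m)"
  unfolding periodic_def
proof (intro allI)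
  fix x j
  have "wavevec L m \<bullet> (x + axis j (L $ j)) = wavevec L m \<bullet> x + 2 * pi * of_int (m $ j)"
    using assms[of j] by (simp add: inner_add_right inner_axis wavevec_def)
  then show "fourier_mode L m (x + axis j (L $ j)) = fourier_mode L m x"
    using exp_integer_2pi[of "of_int (m $ j)"] by (simp add: fourier_mode_def distrib_left exp_add mult_ac)
qed

lemma measurable_cnj [measurable]: "cnj \<in> borel_measurable borel"
  by (intro borel_measurable_continuous_onI continuous_intros)

lemma set_integral_fourier_mode:
  fixes L :: "real^'n"
  assumes "\<And>j. L $ j > 0"
  shows "(LINT x:box 0 L|lebesgue. fourier_mode L m x) = (if m = 0 then of_real (\<Prod>j\<in>UNIV. L $ j) else 0)"
proof -
  let ?e = "\<lambda>j t. exp (\<i> * of_real (2 * pi * of_int (m $ j) / L $ j * t))"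
  have "(LINT x:box 0 L|lebesgue. fourier_mode L m x) = (\<Prod>j\<in>UNIV. LBINT t:{0<..<L $ j}. ?e j t)"
    unfolding fourier_mode_cart
  proof (rule integral_box_prod)
    fix j
    have "set_integrable lborel {0..L $ j} (?e j)"
      unfolding set_integrable_def by (rule borel_integrable_compact)
        (use assms[of j] in \<open>auto intro!: continuous_intros\<close>)
    then show "set_integrable lborel {0<..<L $ j} (?e j)"
      by (rule set_integrable_subset) auto
  qed (use measurable_fourier_mode[of L m] in \<open>simp add: fourier_mode_cart[abs_def]\<close>)
  also have "\<dots> = (\<Prod>j\<in>UNIV. if m $ j = 0 then of_real (L $ j) else 0)"
  proof (rule prod.cong[OF refl])
    fix j
    show "(LBINT t:{0<..<L $ j}. ?e j t) = (if m $ j = 0 then of_real (L $ j) else 0)"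
      using assms[of j] integral_exp_period[OF assms[of j], of "m $ j"]
      by (auto simp: set_lebesgue_integral_def scaleR_conv_of_real)
  qed
  also have "\<dots> = (if m = 0 then of_real (\<Prod>j\<in>UNIV. L $ j) else 0)"
    by (auto simp: vec_eq_iff)
  finally show ?thesis .
qed

section \<open>Fourier coefficients of square integrable periodic functions\<close>

lemma finite_measure_cell: "finite_measure (lebesgue_on (box 0 L))" for L :: "real^'n"
  by (intro finite_measure_restrict_space finite_measure_lebesgue_on) auto

text \<open>
  The next facts restate the set-relative notions in terms of the finite measure
  \<open>lebesgue_on (box 0 L)\<close>, for which the general integration theory applies directly.
\<close>
lemma set_integral_cell:
  fixes f :: "real^'n \<Rightarrow> 'b::{banach, second_countable_topology}"
  shows "(LINT x:box 0 L|lebesgue. f x) = integral\<^sup>L (lebesgue_on (box 0 L)) f"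
  by (simp add: integral_restrict_space set_lebesgue_integral_def)

lemma AE_cell:
  fixes L :: "real^'n"
  shows "(AE x\<in>box 0 L in lebesgue. P x) \<longleftrightarrow> (AE x in lebesgue_on (box 0 L). P x)"
  by (simp add: AE_restrict_space_iff)

lemma L2_per_cell:
  fixes L :: "real^'n"
  shows "f \<in> L2_per L \<longleftrightarrow> periodic L f \<and> f \<in> borel_measurable (lebesgue_on (box 0 L)) \<and>
    integrable (lebesgue_on (box 0 L)) (\<lambda>x. (cmod (f x))\<^sup>2)"
  by (simp add: L2_per_def set_borel_measurable_def borel_measurable_restrict_space_iff
      integrable_restrict_space set_integrable_def)

lemma measurable_fourier_mode_cell [measurable]:
  "fourier_mode L m \<in> borel_measurable (lebesgue_on (box 0 L))"
  by (intro measurable_restrict_space1 measurable_completion) simp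

lemma fourier_mode_in_L2_per:
  assumes "\<And>j. L $ j \<noteq> 0"
  shows "fourier_mode L m \<in> L2_per L"
proof -
  interpret finite_measure "lebesgue_on (box 0 L)" by (rule finite_measure_cell)
  show ?thesis
    by (simp add: L2_per_cell periodic_fourier_mode assms measurable_fourier_mode_cell)
qed

lemma scale_in_L2_per:
  assumes "f \<in> L2_per L"
  shows "(\<lambda>x. c * f x) \<in> L2_per L"
  using assms by (auto simp: L2_per_cell periodic_def norm_mult power_mult_distrib)

lemma fourier_coeff_fourier_mode:
  fixes L :: "real^'n"
  assumes "\<And>j. L $ j > 0"
  shows "fourier_coeff L (fourier_mode L n) m = (if n = m then 1 else 0)"
proof -
  have "(\<Prod>j\<in>UNIV. L $ j) \<noteq> 0"
    using assms by (simp add: less_imp_neq[THEN not_sym])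
  then show ?thesis
    using assms by (simp add: fourier_coeff_def fourier_mode_mult_cnj set_integral_fourier_mode)
qed

lemma fourier_coeff_trig_poly:
  fixes L :: "real^'n"
  assumes "\<And>j. L $ j > 0" and "finite M"
  shows "fourier_coeff L (\<lambda>x. \<Sum>n\<in>M. a n * fourier_mode L n x) m = (if m \<in> M then a m else 0)"
proof -
  interpret finite_measure "lebesgue_on (box 0 L)" by (rule finite_measure_cell)
  have int: "integrable (lebesgue_on (box 0 L)) (\<lambda>x. a n * (fourier_mode L n x * cnj (fourier_mode L m x)))" for n
    unfolding fourier_mode_mult_cnj
    by (rule integrable_const_bound[where B = "cmod (a n)"]) (auto simp: norm_mult)
  have "fourier_coeff L (\<lambda>x. \<Sum>n\<in>M. a n * fourier_mode L n x) m
      = (\<Sum>n\<in>M. a n * fourier_coeff L (fourier_mode L n) m)"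
    using int by (simp add: fourier_coeff_def set_integral_cell sum_distrib_right mult.assoc
        Bochner_Integration.integral_sum sum_divide_distrib)
  also have "\<dots> = (\<Sum>n\<in>M. if n = m then a n else 0)"
    by (intro sum.cong) (simp_all add: fourier_coeff_fourier_mode assms)
  also have "\<dots> = (if m \<in> M then a m else 0)"
    using assms(2) by simp
  finally show ?thesis .
qed

lemma trig_poly_in_L2_per:
  fixes L :: "real^'n"
  assumes "\<And>j. L $ j \<noteq> 0"
  shows "(\<lambda>x. \<Sum>n\<in>M. a n * fourier_mode L n x) \<in> L2_per L"
proof -
  interpret finite_measure "lebesgue_on (box 0 L)" by (rule finite_measure_cell)
  let ?S = "\<lambda>x. \<Sum>n\<in>M. a n * fourier_mode L n x"
  have bound: "cmod (?S x) \<le> (\<Sum>n\<in>M. cmod (a n))" for x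
    by (rule order_trans[OF norm_sum]) (simp add: norm_mult)
  have "integrable (lebesgue_on (box 0 L)) (\<lambda>x. (cmod (?S x))\<^sup>2)"
    by (rule integrable_const_bound[where B = "(\<Sum>n\<in>M. cmod (a n))\<^sup>2"])
      (use bound in \<open>auto intro!: power_mono\<close>)
  moreover have "periodic L ?S"
    using periodic_fourier_mode[OF assms] by (simp add: periodic_def)
  ultimately show ?thesis
    by (simp add: L2_per_cell)
qed

lemma diff_in_L2_per:
  fixes L :: "real^'n"
  assumes "f \<in> L2_per L" "g \<in> L2_per L"
  shows "(\<lambda>x. f x - g x) \<in> L2_per L"
proof -
  have [measurable]: "f \<in> borel_measurable (lebesgue_on (box 0 L))"
      "g \<in> borel_measurable (lebesgue_on (box 0 L))"
    using assms by (auto simp: L2_per_cell)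
  have bound: "(cmod (f x - g x))\<^sup>2 \<le> 2 * (cmod (f x))\<^sup>2 + 2 * (cmod (g x))\<^sup>2" for x
  proof -
    have "(cmod (f x - g x))\<^sup>2 \<le> (cmod (f x) + cmod (g x))\<^sup>2"
      by (intro power_mono norm_triangle_ineq4) simp
    also have "\<dots> \<le> 2 * (cmod (f x))\<^sup>2 + 2 * (cmod (g x))\<^sup>2"
      using sum_squares_bound[of "cmod (f x)" "cmod (g x)"] by (simp add: power2_sum)
    finally show ?thesis .
  qed
  have "integrable (lebesgue_on (box 0 L)) (\<lambda>x. (cmod (f x - g x))\<^sup>2)"
  proof (rule Bochner_Integration.integrable_bound)
    show "integrable (lebesgue_on (box 0 L)) (\<lambda>x. 2 * (cmod (f x))\<^sup>2 + 2 * (cmod (g x))\<^sup>2)"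
      using assms by (simp add: L2_per_cell)
    show "AE x in lebesgue_on (box 0 L). norm ((cmod (f x - g x))\<^sup>2)
        \<le> norm (2 * (cmod (f x))\<^sup>2 + 2 * (cmod (g x))\<^sup>2)"
      using bound by simp
  qed simp
  with assms show ?thesis
    by (simp add: L2_per_cell periodic_def)
qed

lemma integrable_mult_cnj_mode:
  fixes L :: "real^'n"
  assumes "f \<in> L2_per L"
  shows "integrable (lebesgue_on (box 0 L)) (\<lambda>x. f x * cnj (fourier_mode L m x))"
proof -
  interpret finite_measure "lebesgue_on (box 0 L)" by (rule finite_measure_cell)
  have [measurable]: "f \<in> borel_measurable (lebesgue_on (box 0 L))"
    using assms by (simp add: L2_per_cell)
  have "integrable (lebesgue_on (box 0 L)) (\<lambda>x. cmod (f x))"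
    by (rule square_integrable_imp_integrable[of "\<lambda>x. cmod (f x)"])
      (use assms in \<open>auto simp: L2_per_cell\<close>)
  then show ?thesis
    by (rule Bochner_Integration.integrable_bound) (auto simp: norm_mult)
qed

lemma fourier_coeff_diff:
  fixes L :: "real^'n"
  assumes "f \<in> L2_per L" "g \<in> L2_per L"
  shows "fourier_coeff L (\<lambda>x. f x - g x) m = fourier_coeff L f m - fourier_coeff L g m"
  using assms[THEN integrable_mult_cnj_mode]
  by (simp add: fourier_coeff_def set_integral_cell left_diff_distrib diff_divide_distrib)

text \<open>
  Continuity of Fourier coefficients in \<open>L\<^sup>2\<close>: the modes have modulus 1, so a coefficient is bounded
  by the \<open>L\<^sup>1\<close> norm, and on a cell of finite measure this is bounded by the \<open>L\<^sup>2\<close> norm.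
\<close>
lemma norm_fourier_coeff_le:
  fixes L :: "real^'n"
  assumes "f \<in> L2_per L"
  defines "N \<equiv> lebesgue_on (box 0 L)"
  shows "cmod (fourier_coeff L f m) \<le>
    sqrt (measure N (space N) * (LINT x:box 0 L|lebesgue. (cmod (f x))\<^sup>2)) / \<bar>\<Prod>j\<in>UNIV. L $ j\<bar>"
proof -
  interpret finite_measure N unfolding N_def by (rule finite_measure_cell)
  have f: "f \<in> borel_measurable N" "integrable N (\<lambda>x. (cmod (f x))\<^sup>2)"
    using assms by (auto simp: L2_per_cell)
  have "cmod (\<integral>x. f x * cnj (fourier_mode L m x) \<partial>N) \<le> (\<integral>x. cmod (f x * cnj (fourier_mode L m x)) \<partial>N)"
    by (rule integral_norm_bound)
  also have "\<dots> \<le> sqrt (measure N (space N) * (\<integral>x. (cmod (f x))\<^sup>2 \<partial>N))"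
    using integral_norm_squared_le[OF f] by (simp add: norm_mult real_le_rsqrt)
  finally show ?thesis
    by (simp add: fourier_coeff_def set_integral_cell norm_divide N_def divide_right_mono
        flip: of_real_prod)
qed

section \<open>The positive spectrum\<close>

text \<open>
  The \<open>m\<close>-th coefficient of every partial sum over a set containing \<open>m\<close> already has the value on
  the right, and the partial sums converge to \<open>g\<close> in \<open>L\<^sup>2\<close>.
\<close>
lemma fourier_coeff_frac_laplacian:
  fixes L :: "real^'n"
  assumes L: "\<And>j. L $ j > 0" and fg: "frac_laplacian \<alpha> L f g"
  shows "fourier_coeff L g m = of_real (norm (wavevec L m) powr \<alpha>) * fourier_coeff L f m"
proof -
  define a where "a n = of_real (norm (wavevec L n) powr \<alpha>) * fourier_coeff L f n" for n
  define S where "S M x = (\<Sum>n\<in>M. a n * fourier_mode L n x)" for M x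
  define C where "C = measure (lebesgue_on (box 0 L)) (space (lebesgue_on (box 0 L)))"
  have L0: "L $ j \<noteq> 0" for j
    using L[of j] by simp
  have g: "g \<in> L2_per L" and S: "S M \<in> L2_per L" for M
    using fg trig_poly_in_L2_per[OF L0] by (auto simp: frac_laplacian_def S_def[abs_def])
  have lim: "((\<lambda>M. LINT x:box 0 L|lebesgue. (cmod (g x - S M x))\<^sup>2) \<longlongrightarrow> 0) (finite_subsets_at_top UNIV)"
    using fg by (simp add: frac_laplacian_def S_def a_def)
  have "((\<lambda>M. sqrt (C * (LINT x:box 0 L|lebesgue. (cmod (g x - S M x))\<^sup>2)) / \<bar>\<Prod>j\<in>UNIV. L $ j\<bar>)
      \<longlongrightarrow> sqrt (C * 0) / \<bar>\<Prod>j\<in>UNIV. L $ j\<bar>) (finite_subsets_at_top UNIV)"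
    using lim by (intro tendsto_intros) (use L0 in auto)
  moreover have "\<forall>\<^sub>F M in finite_subsets_at_top UNIV. cmod (fourier_coeff L g m - a m)
      \<le> sqrt (C * (LINT x:box 0 L|lebesgue. (cmod (g x - S M x))\<^sup>2)) / \<bar>\<Prod>j\<in>UNIV. L $ j\<bar>"
    unfolding eventually_finite_subsets_at_top
  proof (intro exI[of _ "{m}"] conjI allI impI)
    fix M :: "(int^'n) set" assume M: "finite M \<and> {m} \<subseteq> M \<and> M \<subseteq> UNIV"
    then have "fourier_coeff L (S M) m = a m"
      using fourier_coeff_trig_poly[OF L, of M] by (simp add: S_def[abs_def])
    then show "cmod (fourier_coeff L g m - a m)
        \<le> sqrt (C * (LINT x:box 0 L|lebesgue. (cmod (g x - S M x))\<^sup>2)) / \<bar>\<Prod>j\<in>UNIV. L $ j\<bar>"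
      using norm_fourier_coeff_le[OF diff_in_L2_per[OF g S], of M m] fourier_coeff_diff[OF g S, of M m]
      by (simp add: C_def)
  qed auto
  ultimately have "cmod (fourier_coeff L g m - a m) \<le> sqrt (C * 0) / \<bar>\<Prod>j\<in>UNIV. L $ j\<bar>"
    by (rule tendsto_lowerbound) simp
  then show ?thesis
    by (simp add: a_def)
qed

text \<open>
  All partial sums of the defining series vanish, so the \<open>L\<^sup>2\<close> distance between them and \<open>g\<close> is the
  constant \<open>\<parallel>g\<parallel>\<close>, which must equal its limit 0.
\<close>
lemma frac_laplacian_zero_coeffs:
  fixes L :: "real^'n"
  assumes fg: "frac_laplacian \<alpha> L f g" and "\<And>m. fourier_coeff L f m = 0"
  shows "AE x\<in>box 0 L in lebesgue. g x = 0"
proof -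
  let ?I = "LINT x:box 0 L|lebesgue. (cmod (g x))\<^sup>2"
  have "((\<lambda>M :: (int^'n) set. ?I) \<longlongrightarrow> 0) (finite_subsets_at_top UNIV)"
    using assms by (simp add: frac_laplacian_def)
  then have "?I = 0"
    by (simp add: tendsto_const_iff)
  moreover have "integrable (lebesgue_on (box 0 L)) (\<lambda>x. (cmod (g x))\<^sup>2)"
    using fg by (simp add: frac_laplacian_def L2_per_cell)
  ultimately have "AE x in lebesgue_on (box 0 L). (cmod (g x))\<^sup>2 = 0"
    by (subst (asm) set_integral_cell, subst (asm) integral_nonneg_eq_0_iff_AE) auto
  then show ?thesis
    by (simp add: AE_cell)
qed

lemma fourier_coeff_scale_AE:
  fixes L :: "real^'n"
  assumes "AE x\<in>box 0 L in lebesgue. g x = c * f x" and "f \<in> L2_per L" "g \<in> L2_per L"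
  shows "fourier_coeff L g m = c * fourier_coeff L f m"
proof -
  have [measurable]: "f \<in> borel_measurable (lebesgue_on (box 0 L))"
      "g \<in> borel_measurable (lebesgue_on (box 0 L))"
    using assms by (auto simp: L2_per_cell)
  have "(\<integral>x. g x * cnj (fourier_mode L m x) \<partial>lebesgue_on (box 0 L))
      = (\<integral>x. c * (f x * cnj (fourier_mode L m x)) \<partial>lebesgue_on (box 0 L))"
    using assms(1) by (intro integral_cong_AE) (auto simp: AE_cell)
  then show ?thesis
    by (simp add: fourier_coeff_def set_integral_cell)
qed

text \<open>
  By orthogonality a partial sum equals its limit as soon as its index set contains \<open>m\<close>.
\<close>
lemma frac_laplacian_fourier_mode:
  fixes L :: "real^'n"
  assumes L: "\<And>j. L $ j > 0"
  shows "frac_laplacian \<alpha> L (fourier_mode L m)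
    (\<lambda>x. of_real (norm (wavevec L m) powr \<alpha>) * fourier_mode L m x)"
proof -
  define c where "c n = complex_of_real (norm (wavevec L n) powr \<alpha>)" for n
  have L0: "L $ j \<noteq> 0" for j
    using L[of j] by simp
  have "(\<Sum>n\<in>M. c n * fourier_coeff L (fourier_mode L m) n * fourier_mode L n x) = c m * fourier_mode L m x"
    if "finite M" "m \<in> M" for M x
  proof -
    have "(\<Sum>n\<in>M. c n * fourier_coeff L (fourier_mode L m) n * fourier_mode L n x)
        = (\<Sum>n\<in>M. if m = n then c n * fourier_mode L n x else 0)"
      by (intro sum.cong) (simp_all add: fourier_coeff_fourier_mode L)
    then show ?thesis
      using that by simp
  qed
  then have "\<forall>\<^sub>F M in finite_subsets_at_top UNIV. (LINT x:box 0 L|lebesgue.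
      (cmod (c m * fourier_mode L m x -
        (\<Sum>n\<in>M. c n * fourier_coeff L (fourier_mode L m) n * fourier_mode L n x)))\<^sup>2) = 0"
    unfolding eventually_finite_subsets_at_top
    by (intro exI[of _ "{m}"]) (auto simp: set_lebesgue_integral_def)
  then have "((\<lambda>M. LINT x:box 0 L|lebesgue.
      (cmod (c m * fourier_mode L m x -
        (\<Sum>n\<in>M. c n * fourier_coeff L (fourier_mode L m) n * fourier_mode L n x)))\<^sup>2) \<longlongrightarrow> 0)
      (finite_subsets_at_top UNIV)"
    by (rule tendsto_eventually)
  then show ?thesis
    unfolding frac_laplacian_def c_def
    using fourier_mode_in_L2_per[OF L0] scale_in_L2_per by blast
qed

text \<open>
  The eigenfunction is the mode itself; it vanishes nowhere and the cell has positive measure.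
\<close>
lemma eigenvalue_norm_wavevec:
  fixes L :: "real^'n"
  assumes L: "\<And>j. L $ j > 0"
  shows "eigenvalue \<alpha> (\<lambda>x. 0) L (norm (wavevec L m) powr \<alpha>)"
proof -
  have "\<not> (AE x\<in>box 0 L in lebesgue. fourier_mode L m x = 0)"
  proof
    assume "AE x\<in>box 0 L in lebesgue. fourier_mode L m x = 0"
    moreover have "fourier_mode L m x \<noteq> 0" for x
      by (simp add: fourier_mode_def)
    ultimately have "AE x in lebesgue. x \<notin> box 0 L"
      by simp
    then have "negligible (box 0 L)"
      by (simp add: negligible_iff_null_sets AE_iff_null_sets)
    then have "box 0 L = {}"
      using open_not_negligible[OF open_box] by blast
    moreover have "L /\<^sub>R 2 \<in> box 0 L"
      using L by (simp add: mem_box_cart)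
    ultimately show False
      by simp
  qed
  then show ?thesis
    unfolding eigenvalue_def eigenfunction_def
    using frac_laplacian_fourier_mode[OF L] by fastforce
qed

text \<open>
  An eigenfunction whose eigenvalue is no \<open>\<bar>k\<bar>\<^sup>\<alpha>\<close> has only zero coefficients, hence image zero
  under the operator.  Since \<open>\<nu> \<noteq> 0\<close>, the eigenfunction, a multiple of its image, is zero too.
\<close>
lemma positive_eigenvalue_iff:
  fixes L :: "real^'n"
  assumes L: "\<And>j. L $ j > 0" and "\<nu> > 0"
  shows "eigenvalue \<alpha> (\<lambda>x. 0) L \<nu> \<longleftrightarrow> (\<exists>m. \<nu> = norm (wavevec L m) powr \<alpha>)"
proof
  assume "eigenvalue \<alpha> (\<lambda>x. 0) L \<nu>"
  then obtain f g where nz: "\<not> (AE x\<in>box 0 L in lebesgue. f x = 0)"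
    and fg: "frac_laplacian \<alpha> L f g"
    and ae: "AE x\<in>box 0 L in lebesgue. g x = of_real \<nu> * f x"
    unfolding eigenvalue_def eigenfunction_def by auto
  have coeff: "of_real (norm (wavevec L m) powr \<alpha>) * fourier_coeff L f m = of_real \<nu> * fourier_coeff L f m" for m
    using fourier_coeff_frac_laplacian[OF L fg] fourier_coeff_scale_AE[OF ae] fg
    by (simp add: frac_laplacian_def)
  show "\<exists>m. \<nu> = norm (wavevec L m) powr \<alpha>"
  proof (rule ccontr)
    assume "\<nexists>m. \<nu> = norm (wavevec L m) powr \<alpha>"
    then have "fourier_coeff L f m = 0" for m
      using coeff[of m] by auto
    then have "AE x\<in>box 0 L in lebesgue. g x = 0"
      by (rule frac_laplacian_zero_coeffs[OF fg])
    with ae have "AE x\<in>box 0 L in lebesgue. f x = 0"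
      by eventually_elim (use \<open>\<nu> > 0\<close> in auto)
    with nz show False ..
  qed
qed (use eigenvalue_norm_wavevec[OF L] in auto)

text \<open>
  As \<open>t \<mapsto> t\<^sup>\<alpha>\<close> is strictly increasing for \<open>\<alpha> > 0\<close>, the order of the eigenvalues is the order of
  the lengths of the wave vectors.
\<close>
lemma two_smallest_pos_eigenvaluesI:
  fixes L :: "real^'n"
  assumes L: "\<And>j. L $ j > 0" and "\<alpha> > 0"
    and "0 < norm (wavevec L m\<^sub>1)" "norm (wavevec L m\<^sub>1) < norm (wavevec L m\<^sub>2)"
    and least: "\<And>m. wavevec L m \<noteq> 0 \<Longrightarrow>
      norm (wavevec L m) = norm (wavevec L m\<^sub>1) \<or> norm (wavevec L m\<^sub>2) \<le> norm (wavevec L m)"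
  shows "two_smallest_pos_eigenvalues \<alpha> (\<lambda>x. 0) L
    (norm (wavevec L m\<^sub>1) powr \<alpha>) (norm (wavevec L m\<^sub>2) powr \<alpha>)"
  unfolding two_smallest_pos_eigenvalues_def
proof (intro conjI allI impI)
  fix \<nu> :: real assume "0 < \<nu>" "eigenvalue \<alpha> (\<lambda>x. 0) L \<nu>"
  then obtain m where m: "\<nu> = norm (wavevec L m) powr \<alpha>"
    using positive_eigenvalue_iff[OF L] by blast
  with \<open>0 < \<nu>\<close> have "wavevec L m \<noteq> 0"
    by auto
  from least[OF this] show "\<nu> = norm (wavevec L m\<^sub>1) powr \<alpha> \<or> norm (wavevec L m\<^sub>2) powr \<alpha> \<le> \<nu>"
    using m \<open>\<alpha> > 0\<close> by (auto intro: powr_mono2)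
qed (use assms in \<open>auto intro: eigenvalue_norm_wavevec powr_less_mono2\<close>)

lemma fundamental_gap_eqI:
  assumes "two_smallest_pos_eigenvalues \<alpha> V L \<mu>\<^sub>1 \<mu>\<^sub>2"
  shows "fundamental_gap \<alpha> V L = \<mu>\<^sub>2 - \<mu>\<^sub>1"
  unfolding fundamental_gap_def
  using assms by (intro the_equality) (auto dest: two_smallest_pos_eigenvalues_unique)

section \<open>The shortest wave vectors of a rectangle\<close>

lemma norm_wavevec_2:
  fixes L :: "real^2"
  shows "norm (wavevec L m) = 2 * pi * sqrt ((m $ 1 / L $ 1)\<^sup>2 + (m $ 2 / L $ 2)\<^sup>2)"
proof -
  have "norm (wavevec L m) = sqrt ((2 * pi)\<^sup>2 * ((m $ 1 / L $ 1)\<^sup>2 + (m $ 2 / L $ 2)\<^sup>2))"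
    by (simp add: norm_vec_def L2_set_def sum_2 wavevec_def power_divide power_mult_distrib distrib_left)
  then show ?thesis
    by (simp add: real_sqrt_mult)
qed

lemma power2_divide_mono:
  fixes l :: real and k c :: int
  assumes "l > 0" "\<bar>k\<bar> \<le> \<bar>c\<bar>"
  shows "(k / l)\<^sup>2 \<le> (c / l)\<^sup>2"
proof -
  have "\<bar>k / l\<bar> \<le> \<bar>c / l\<bar>"
    using assms by (simp add: abs_divide divide_right_mono flip: of_int_abs)
  then show ?thesis
    by (simp only: abs_le_square_iff)
qed

text \<open>
  Here \<open>q c d\<close> is the squared length of the wave vector of \<open>(c, d)\<close> up to the factor \<open>(2\<pi>)\<^sup>2\<close>, and
  \<open>(a, b)\<close> is the candidate for the second shortest length; both hypotheses on it are statements
  about this quadratic form on integers.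
\<close>
lemma rectangle_two_smallest:
  fixes L :: "real^2" and a b :: int
  assumes "L $ 1 > 0" "L $ 2 > 0" "\<alpha> > 0"
    and q: "\<And>c d. q c d = (of_int c / L $ 1)\<^sup>2 + (of_int d / L $ 2)\<^sup>2"
    and gt: "q 1 0 < q a b"
    and least: "\<And>c d. c \<noteq> 0 \<or> d \<noteq> 0 \<Longrightarrow> q c d = q 1 0 \<or> q a b \<le> q c d"
  shows "two_smallest_pos_eigenvalues \<alpha> (\<lambda>x. 0) L
    ((2 * pi / L $ 1) powr \<alpha>) ((2 * pi * sqrt (q a b)) powr \<alpha>)"
proof -
  have norm_eq: "norm (wavevec L m) = 2 * pi * sqrt (q (m $ 1) (m $ 2))" for m
    by (simp add: norm_wavevec_2 q)
  have m1: "norm (wavevec L (vector [1, 0])) = 2 * pi / L $ 1"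
    using assms(1) by (simp add: norm_eq q real_sqrt_divide)
  have m2: "norm (wavevec L (vector [a, b])) = 2 * pi * sqrt (q a b)"
    by (simp add: norm_eq)
  have "two_smallest_pos_eigenvalues \<alpha> (\<lambda>x. 0) L
    (norm (wavevec L (vector [1, 0])) powr \<alpha>) (norm (wavevec L (vector [a, b])) powr \<alpha>)"
  proof (rule two_smallest_pos_eigenvaluesI)
    show "L $ j > 0" for j
      using assms(1,2) exhaust_2[of j] by auto
    show "0 < norm (wavevec L (vector [1, 0]))"
      using assms(1) by (simp add: m1)
    show "norm (wavevec L (vector [1, 0])) < norm (wavevec L (vector [a, b]))"
      using gt by (simp add: norm_eq)
  next
    fix m assume "wavevec L m \<noteq> 0"
    then have "m $ 1 \<noteq> 0 \<or> m $ 2 \<noteq> 0"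
      by (auto simp: wavevec_def vec_eq_iff forall_2)
    from least[OF this] show "norm (wavevec L m) = norm (wavevec L (vector [1, 0])) \<or>
        norm (wavevec L (vector [a, b])) \<le> norm (wavevec L m)"
      by (auto simp: norm_eq)
  qed (use assms in auto)
  then show ?thesis
    by (simp only: m1 m2)
qed

theorem lemma5p3:
  fixes L1 L2 \<alpha> :: real and L :: "real^2"
  assumes "L1 \<ge> L2" and "L2 > 0" and "0 < \<alpha>" and "\<alpha> \<le> 2"
    and "L = vector [L1, L2]"
  shows "(\<exists>\<mu>\<^sub>1 \<mu>\<^sub>2. two_smallest_pos_eigenvalues \<alpha> (\<lambda>x. 0) L \<mu>\<^sub>1 \<mu>\<^sub>2) \<and>
    (L1 = L2 \<longrightarrow>
       fundamental_gap \<alpha> (\<lambda>x. 0) L = (2 * pi) powr \<alpha> * (2 powr (\<alpha> / 2) - 1) / L1 powr \<alpha>) \<and>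
    (L2 < L1 \<and> L1 \<le> 2 * L2 \<longrightarrow>
       fundamental_gap \<alpha> (\<lambda>x. 0) L = (2 * pi) powr \<alpha> / L2 powr \<alpha> - (2 * pi) powr \<alpha> / L1 powr \<alpha>) \<and>
    (L1 \<ge> 2 * L2 \<longrightarrow>
       fundamental_gap \<alpha> (\<lambda>x. 0) L = (2 * pi) powr \<alpha> * (2 powr \<alpha> - 1) / L1 powr \<alpha>)"
proof -
  have L: "L $ 1 = L1" "L $ 2 = L2" "L1 > 0"
    using assms by simp_all
  define q :: "int \<Rightarrow> int \<Rightarrow> real" where "q c d = (c / L1)\<^sup>2 + (d / L2)\<^sup>2" for c d
  have mono: "q c d \<le> q c' d'" if "\<bar>c\<bar> \<le> \<bar>c'\<bar>" "\<bar>d\<bar> \<le> \<bar>d'\<bar>" for c d c' d'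
    unfolding q_def using that \<open>L1 > 0\<close> \<open>L2 > 0\<close> by (intro add_mono power2_divide_mono)
  have two_smallest: "two_smallest_pos_eigenvalues \<alpha> (\<lambda>x. 0) L ((2 * pi / L1) powr \<alpha>) ((2 * pi * sqrt (q a b)) powr \<alpha>)"
    if "q 1 0 < q a b" "\<And>c d. c \<noteq> 0 \<or> d \<noteq> 0 \<Longrightarrow> q c d = q 1 0 \<or> q a b \<le> q c d" for a b
    using rectangle_two_smallest[of L \<alpha> q a b] that L \<open>L2 > 0\<close> \<open>\<alpha> > 0\<close> by (simp add: q_def)
  have axis_first: "q c 0 = q 1 0" if "\<bar>c\<bar> = 1" for c
    using mono[of c 1 0 0] mono[of 1 c 0 0] that by force

  have square: "two_smallest_pos_eigenvalues \<alpha> (\<lambda>x. 0) L ((2 * pi / L1) powr \<alpha>) ((2 * pi * sqrt (q 1 1)) powr \<alpha>)"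
    if "L1 = L2"
  proof (rule two_smallest)
    show "q 1 0 < q 1 1"
      using \<open>L2 > 0\<close> by (simp add: q_def)
    fix c d :: int assume "c \<noteq> 0 \<or> d \<noteq> 0"
    then consider "1 \<le> \<bar>c\<bar>" "1 \<le> \<bar>d\<bar>" | "\<bar>c\<bar> = 1" "d = 0" | "c = 0" "\<bar>d\<bar> = 1"
      | "2 \<le> \<bar>c\<bar>" | "2 \<le> \<bar>d\<bar>"
      by linarith
    then show "q c d = q 1 0 \<or> q 1 1 \<le> q c d"
    proof cases
      case 1
      then show ?thesis using mono[of 1 c 1 d] by simp
    next
      case 2
      then show ?thesis using axis_first[of c] by simp
    next
      case 3
      have "q 0 d = q d 0"
        by (simp add: q_def \<open>L1 = L2\<close>)
      with 3 show ?thesis using axis_first[of d] by simp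
    next
      case 4
      have "q 1 1 \<le> q 2 0"
        unfolding q_def \<open>L1 = L2\<close> by (simp add: power_divide flip: add_divide_distrib) (simp add: divide_right_mono)
      also have "\<dots> \<le> q c d"
        using 4 mono by simp
      finally show ?thesis ..
    next
      case 5
      have "q 1 1 \<le> q 0 2"
        unfolding q_def \<open>L1 = L2\<close> by (simp add: power_divide flip: add_divide_distrib) (simp add: divide_right_mono)
      also have "\<dots> \<le> q c d"
        using 5 mono by simp
      finally show ?thesis ..
    qed
  qed
  \<comment> \<open>An index with \<open>d \<noteq> 0\<close> is at least as long as \<open>(0, 1)\<close>; otherwise it is \<open>(\<plusminus>1, 0)\<close> or at least
    as long as \<open>(2, 0)\<close>.  The ratio of the sides decides which of the two bounds is smaller.\<close>
  have least_candidates: "q c d = q 1 0 \<or> min (q 0 1) (q 2 0) \<le> q c d" if "c \<noteq> 0 \<or> d \<noteq> 0" for c d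
  proof -
    consider "1 \<le> \<bar>d\<bar>" | "\<bar>c\<bar> = 1" "d = 0" | "2 \<le> \<bar>c\<bar>"
      using \<open>c \<noteq> 0 \<or> d \<noteq> 0\<close> by linarith
    then show ?thesis
      using mono[of 0 c 1 d] mono[of 2 c 0 d] axis_first[of c] by cases (auto simp: min_le_iff_disj)
  qed
  have intermediate: "two_smallest_pos_eigenvalues \<alpha> (\<lambda>x. 0) L ((2 * pi / L1) powr \<alpha>) ((2 * pi * sqrt (q 0 1)) powr \<alpha>)"
    if "L2 < L1" "L1 \<le> 2 * L2"
  proof (rule two_smallest)
    show "q 1 0 < q 0 1"
      using that \<open>L2 > 0\<close> by (simp add: q_def power_strict_mono divide_strict_left_mono)
    have "(1 / L2)\<^sup>2 \<le> (2 / L1)\<^sup>2"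
      using that \<open>L1 > 0\<close> \<open>L2 > 0\<close> by (intro power_mono) (simp_all add: field_simps)
    then have "q 0 1 \<le> q 2 0"
      by (simp add: q_def)
    then show "q c d = q 1 0 \<or> q 0 1 \<le> q c d" if "c \<noteq> 0 \<or> d \<noteq> 0" for c d
      using least_candidates[OF that] by simp
  qed
  have elongated: "two_smallest_pos_eigenvalues \<alpha> (\<lambda>x. 0) L ((2 * pi / L1) powr \<alpha>) ((2 * pi * sqrt (q 2 0)) powr \<alpha>)"
    if "2 * L2 \<le> L1"
  proof (rule two_smallest)
    show "q 1 0 < q 2 0"
      using \<open>L1 > 0\<close> by (simp add: q_def power_divide divide_strict_right_mono)
    have "(2 / L1)\<^sup>2 \<le> (1 / L2)\<^sup>2"
      using that \<open>L1 > 0\<close> \<open>L2 > 0\<close> by (intro power_mono) (simp_all add: field_simps)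
    then have "q 2 0 \<le> q 0 1"
      by (simp add: q_def)
    then show "q c d = q 1 0 \<or> q 2 0 \<le> q c d" if "c \<noteq> 0 \<or> d \<noteq> 0" for c d
      using least_candidates[OF that] by simp
  qed

  have powr_first: "(2 * pi / L1) powr \<alpha> = (2 * pi) powr \<alpha> / L1 powr \<alpha>"
    using \<open>L1 > 0\<close> by (simp add: powr_divide)
  show ?thesis
  proof (intro conjI impI)
    show "\<exists>\<mu>\<^sub>1 \<mu>\<^sub>2. two_smallest_pos_eigenvalues \<alpha> (\<lambda>x. 0) L \<mu>\<^sub>1 \<mu>\<^sub>2"
      using square intermediate elongated \<open>L1 \<ge> L2\<close> by (cases "L1 = L2"; cases "2 * L2 \<le> L1") force+
  next
    assume "L1 = L2"
    then have "sqrt (q 1 1) = sqrt 2 / L1"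
      using \<open>L1 > 0\<close> by (simp add: q_def power_divide real_sqrt_divide)
    then have "(2 * pi * sqrt (q 1 1)) powr \<alpha> = (2 * pi) powr \<alpha> * sqrt 2 powr \<alpha> / L1 powr \<alpha>"
      using \<open>L1 > 0\<close> by (simp add: powr_divide powr_mult)
    also have "sqrt 2 powr \<alpha> = 2 powr (\<alpha> / 2)"
      by (simp add: powr_powr flip: powr_half_sqrt)
    finally show "fundamental_gap \<alpha> (\<lambda>x. 0) L = (2 * pi) powr \<alpha> * (2 powr (\<alpha> / 2) - 1) / L1 powr \<alpha>"
      by (simp add: fundamental_gap_eqI[OF square[OF \<open>L1 = L2\<close>]] powr_first right_diff_distrib diff_divide_distrib)
  next
    assume A: "L2 < L1 \<and> L1 \<le> 2 * L2"
    have "(2 * pi * sqrt (q 0 1)) powr \<alpha> = (2 * pi) powr \<alpha> / L2 powr \<alpha>"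
      using \<open>L2 > 0\<close> by (simp add: q_def powr_divide real_sqrt_divide)
    with A show "fundamental_gap \<alpha> (\<lambda>x. 0) L = (2 * pi) powr \<alpha> / L2 powr \<alpha> - (2 * pi) powr \<alpha> / L1 powr \<alpha>"
      by (simp add: fundamental_gap_eqI[OF intermediate] powr_first)
  next
    assume A: "L1 \<ge> 2 * L2"
    have "sqrt (q 2 0) = 2 / L1"
      using \<open>L1 > 0\<close> by (simp add: q_def)
    then have "(2 * pi * sqrt (q 2 0)) powr \<alpha> = (2 * pi * 2 / L1) powr \<alpha>"
      by simp
    also have "\<dots> = (2 * pi) powr \<alpha> * 2 powr \<alpha> / L1 powr \<alpha>"
      using \<open>L1 > 0\<close> by (simp only: powr_divide powr_mult)
    finally show "fundamental_gap \<alpha> (\<lambda>x. 0) L = (2 * pi) powr \<alpha> * (2 powr \<alpha> - 1) / L1 powr \<alpha>"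
      by (simp add: fundamental_gap_eqI[OF elongated[OF A]] powr_first right_diff_distrib diff_divide_distrib)
  qed
qed

end
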